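(* Let $\eta\in k\setminus\{0\}$ and let $A=k\langle X,Y\rangle\oplus k1$ be the unital algebra generated by $X,Y$ with $XY=\eta\,YX$. In $A^{\otimes 2}$ put $a=X\otimes X$, $b=X\otimes Y$, $c=Y\otimes X$, $d=Y\otimes Y$. Define elements of $A^{\otimes 2}\times A^{\otimes 2}$ by $$\overrightarrow{\Delta}_M(X)=(X\otimes X,\ X\otimes Y),\qquad \overrightarrow{\Delta}_M(Y)=(Y\otimes Y,\ Y\otimes X),$$ $$\overrightarrow{\tilde\Delta}_M(X)=(X\otimes X,\ Y\otimes X),\qquad \overrightarrow{\tilde\Delta}_M(Y)=(Y\otimes Y,\ X\otimes Y).$$ Then, in $A^{\otimes 2}\otimes A^{\otimes 2}$, $$\langle\overrightarrow{\Delta}_M(X),\overrightarrow{\tilde\Delta}_M(X)\rangle=\Delta(a),\qquad \langle\overrightarrow{\Delta}_M(Y),\overrightarrow{\tilde\Delta}_M(Y)\rangle=\Delta(d),$$ $$\mathrm{per}(\overrightarrow{\Delta}_M(X),\overrightarrow{\tilde\Delta}_M(Y))=\Delta(b),\qquad \mathrm{per}(\overrightarrow{\Delta}_M(Y),\overrightarrow{\tilde\Delta}_M(X))=\Delta(c).$$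
   Context: The field $k$ is $\mathbb{R}$ or $\mathbb{C}$. Here $\Delta$ denotes the coproduct $$\Delta(a)=a\otimes a+b\otimes c,\quad \Delta(b)=a\otimes b+b\otimes d,\quad \Delta(c)=d\otimes c+c\otimes a,\quad \Delta(d)=d\otimes d+c\otimes b.$$ The bilinear map $\square:A^{\otimes 2}\times A^{\otimes 2}\to A^{\otimes 2}\otimes A^{\otimes 2}$ is given by $(y_1\otimes y_2)\,\square\,(y_3\otimes y_4)=(y_1\otimes y_3)\otimes(y_2\otimes y_4)$. The maps $\langle\cdot,\cdot\rangle$ and $\mathrm{per}$ from $(A^{\otimes 2}\times A^{\otimes 2})^{\times 2}$ to $A^{\otimes 2}\otimes A^{\otimes 2}$ are $$\langle(z_1,z_2),(z_3,z_4)\rangle=z_1\,\square\,z_3+z_2\,\square\,z_4,\qquad \mathrm{per}((z_1,z_2),(z_3,z_4))=z_1\,\square\,z_4+z_2\,\square\,z_3.$$ *)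

theory Defs
  imports Complex_Main "HOL-Library.Poly_Mapping" "HOL-Algebra.Algebraic_Closure_Type"
begin

text \<open>
  The constructions below work over any field; the ground fields of interest, the reals and the
  complex numbers, are up to isomorphism exactly the instances of \<^class>\<open>real_normed_field\<close>
  (Gelfand-Mazur).
\<close>

section \<open>Quotients of modules and algebras\<close>

abbreviation scalars :: "('k::field) ring" where
  "scalars \<equiv> ring_of_type_algebra"

text \<open>The submodule spanned by a set, in analogy with \<^const>\<open>genideal\<close>.\<close>

definition genmodule :: "('k::field, 'v) module \<Rightarrow> 'v set \<Rightarrow> 'v set" where
  "genmodule M S = \<Inter>{H. submodule H scalars M \<and> S \<subseteq> H}"

text \<open>
  This is \<^const>\<open>FactRing\<close> with the induced scalar multiplication.  The additive and linear
  structure makes sense for any submodule \<open>N\<close>, the multiplication only for a two-sided ideal.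
\<close>

definition FactModule :: "('k::field, 'v) module \<Rightarrow> 'v set \<Rightarrow> ('k, 'v set) module" where
  "FactModule M N =
    \<lparr>carrier = a_rcosets\<^bsub>M\<^esub> N, monoid.mult = rcoset_mult M N, one = N +>\<^bsub>M\<^esub> \<one>\<^bsub>M\<^esub>, zero = N,
     add = set_add M, module.smult = (\<lambda>c S. \<Union>x\<in>S. N +>\<^bsub>M\<^esub> (c \<odot>\<^bsub>M\<^esub> x))\<rparr>"

definition linear_on ::
    "('k::field, 'v) module \<Rightarrow> ('k, 'w) module \<Rightarrow> 'v set \<Rightarrow> ('v \<Rightarrow> 'w) \<Rightarrow> bool" where
  "linear_on M N V f \<longleftrightarrow> f \<in> V \<rightarrow> carrier N \<and>
    (\<forall>x\<in>V. \<forall>y\<in>V. f (x \<oplus>\<^bsub>M\<^esub> y) = f x \<oplus>\<^bsub>N\<^esub> f y) \<and>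
    (\<forall>c. \<forall>x\<in>V. f (c \<odot>\<^bsub>M\<^esub> x) = c \<odot>\<^bsub>N\<^esub> f x)"

definition bilinear_map ::
    "('k::field, 'u) module \<Rightarrow> ('k, 'v) module \<Rightarrow> ('k, 'w) module \<Rightarrow> ('u \<Rightarrow> 'v \<Rightarrow> 'w) \<Rightarrow> bool" where
  "bilinear_map M N P f \<longleftrightarrow>
    (\<forall>x\<in>carrier M. linear_on N P (carrier N) (f x)) \<and>
    (\<forall>y\<in>carrier N. linear_on M P (carrier M) (\<lambda>x. f x y))"


section \<open>Tensor products over the scalar field\<close>

text \<open>
  The free module on \<open>carrier M \<times> carrier N\<close>, with the product that extends
  \<open>(m, n) (m', n') = (m m', n n')\<close> bilinearly.
\<close>

definition free_on_pairs ::
    "('k::field, 'm) module \<Rightarrow> ('k, 'n) module \<Rightarrow> ('k, ('m \<times> 'n) \<Rightarrow>\<^sub>0 'k) module" where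
  "free_on_pairs M N =
    \<lparr>carrier = {p. Poly_Mapping.keys p \<subseteq> carrier M \<times> carrier N},
     monoid.mult = (\<lambda>p q. \<Sum>x\<in>Poly_Mapping.keys p. \<Sum>y\<in>Poly_Mapping.keys q.
       Poly_Mapping.single (fst x \<otimes>\<^bsub>M\<^esub> fst y, snd x \<otimes>\<^bsub>N\<^esub> snd y)
         (Poly_Mapping.lookup p x * Poly_Mapping.lookup q y)),
     one = Poly_Mapping.single (\<one>\<^bsub>M\<^esub>, \<one>\<^bsub>N\<^esub>) 1, zero = 0, add = (+),
     module.smult = (\<lambda>c. Poly_Mapping.map ((*) c))\<rparr>"

definition tensor_relations ::
    "('k::field, 'm) module \<Rightarrow> ('k, 'n) module \<Rightarrow> (('m \<times> 'n) \<Rightarrow>\<^sub>0 'k) set" where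
  "tensor_relations M N =
    {Poly_Mapping.single (x \<oplus>\<^bsub>M\<^esub> x', y) 1 - Poly_Mapping.single (x, y) 1
        - Poly_Mapping.single (x', y) 1 | x x' y.
      x \<in> carrier M \<and> x' \<in> carrier M \<and> y \<in> carrier N} \<union>
    {Poly_Mapping.single (x, y \<oplus>\<^bsub>N\<^esub> y') 1 - Poly_Mapping.single (x, y) 1
        - Poly_Mapping.single (x, y') 1 | x y y'.
      x \<in> carrier M \<and> y \<in> carrier N \<and> y' \<in> carrier N} \<union>
    {Poly_Mapping.single (c \<odot>\<^bsub>M\<^esub> x, y) 1 - Poly_Mapping.single (x, y) c | c x y.
      x \<in> carrier M \<and> y \<in> carrier N} \<union>
    {Poly_Mapping.single (x, c \<odot>\<^bsub>N\<^esub> y) 1 - Poly_Mapping.single (x, y) c | c x y.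
      x \<in> carrier M \<and> y \<in> carrier N}"

definition tensor_null ::
    "('k::field, 'm) module \<Rightarrow> ('k, 'n) module \<Rightarrow> (('m \<times> 'n) \<Rightarrow>\<^sub>0 'k) set" where
  "tensor_null M N = genmodule (free_on_pairs M N) (tensor_relations M N)"

definition tensor_product ::
    "('k::field, 'm) module \<Rightarrow> ('k, 'n) module \<Rightarrow> ('k, (('m \<times> 'n) \<Rightarrow>\<^sub>0 'k) set) module" where
  "tensor_product M N = FactModule (free_on_pairs M N) (tensor_null M N)"

definition pure_tensor ::
    "('k::field, 'm) module \<Rightarrow> ('k, 'n) module \<Rightarrow> 'm \<Rightarrow> 'n \<Rightarrow> (('m \<times> 'n) \<Rightarrow>\<^sub>0 'k) set" where
  "pure_tensor M N x y =
    tensor_null M N +>\<^bsub>free_on_pairs M N\<^esub> Poly_Mapping.single (x, y) 1"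


section \<open>The algebra generated by X and Y with XY = \<open>\<eta>\<close> YX\<close>

datatype gen = GenX | GenY

text \<open>
  Words under concatenation, written additively so that finitely supported functions on
  words carry the convolution product, i.e. form the free associative unital algebra.
\<close>

datatype word = Word "gen list"

instantiation word :: monoid_add
begin

definition zero_word :: word where "0 = Word []"

fun plus_word :: "word \<Rightarrow> word \<Rightarrow> word" where
  "Word u + Word v = Word (u @ v)"

instance
proof
  fix a b c :: word
  show "a + b + c = a + (b + c)" by (cases a; cases b; cases c) simp
  show "0 + a = a" by (cases a) (simp add: zero_word_def)
  show "a + 0 = a" by (cases a) (simp add: zero_word_def)
qed

end

type_synonym 'k free_alg = "word \<Rightarrow>\<^sub>0 'k"

definition free_algebra :: "('k::field, 'k free_alg) module" where
  "free_algebra =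
    \<lparr>carrier = UNIV, monoid.mult = (*), one = 1, zero = 0, add = (+),
     module.smult = (\<lambda>c. Poly_Mapping.map ((*) c))\<rparr>"

definition free_gen :: "gen \<Rightarrow> ('k::field) free_alg" where
  "free_gen g = Poly_Mapping.single (Word [g]) 1"

definition plane_ideal :: "'k::field \<Rightarrow> 'k free_alg set" where
  "plane_ideal \<eta> = genideal free_algebra
    {free_gen GenX * free_gen GenY
      - Poly_Mapping.map ((*) \<eta>) (free_gen GenY * free_gen GenX)}"

type_synonym 'k alg = "'k free_alg set"
type_synonym 'k alg2 = "(('k alg \<times> 'k alg) \<Rightarrow>\<^sub>0 'k) set"
type_synonym 'k alg4 = "(('k alg2 \<times> 'k alg2) \<Rightarrow>\<^sub>0 'k) set"

definition plane :: "'k::field \<Rightarrow> ('k, 'k alg) module" where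
  "plane \<eta> = FactModule free_algebra (plane_ideal \<eta>)"

definition gen_elem :: "'k::field \<Rightarrow> gen \<Rightarrow> 'k alg" where
  "gen_elem \<eta> g = plane_ideal \<eta> +>\<^bsub>free_algebra\<^esub> free_gen g"

abbreviation plane_X :: "'k::field \<Rightarrow> 'k alg" where "plane_X \<eta> \<equiv> gen_elem \<eta> GenX"
abbreviation plane_Y :: "'k::field \<Rightarrow> 'k alg" where "plane_Y \<eta> \<equiv> gen_elem \<eta> GenY"

abbreviation plane2 :: "'k::field \<Rightarrow> ('k, 'k alg2) module" where
  "plane2 \<eta> \<equiv> tensor_product (plane \<eta>) (plane \<eta>)"

abbreviation plane4 :: "'k::field \<Rightarrow> ('k, 'k alg4) module" where
  "plane4 \<eta> \<equiv> tensor_product (plane2 \<eta>) (plane2 \<eta>)"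

abbreviation tensor2 :: "'k alg \<Rightarrow> 'k::field \<Rightarrow> 'k alg \<Rightarrow> 'k alg2"
    (\<open>(_ \<otimes>\<^sub>2[_] _)\<close> [71, 0, 71] 70) where
  "x \<otimes>\<^sub>2[\<eta>] y \<equiv> pure_tensor (plane \<eta>) (plane \<eta>) x y"

abbreviation tensor4 :: "'k alg2 \<Rightarrow> 'k::field \<Rightarrow> 'k alg2 \<Rightarrow> 'k alg4"
    (\<open>(_ \<otimes>\<^sub>4[_] _)\<close> [71, 0, 71] 70) where
  "z \<otimes>\<^sub>4[\<eta>] w \<equiv> pure_tensor (plane2 \<eta>) (plane2 \<eta>) z w"


section \<open>The coproduct, the bracket and the permanent\<close>

definition elem_a :: "'k::field \<Rightarrow> 'k alg2" where "elem_a \<eta> = plane_X \<eta> \<otimes>\<^sub>2[\<eta>] plane_X \<eta>"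
definition elem_b :: "'k::field \<Rightarrow> 'k alg2" where "elem_b \<eta> = plane_X \<eta> \<otimes>\<^sub>2[\<eta>] plane_Y \<eta>"
definition elem_c :: "'k::field \<Rightarrow> 'k alg2" where "elem_c \<eta> = plane_Y \<eta> \<otimes>\<^sub>2[\<eta>] plane_X \<eta>"
definition elem_d :: "'k::field \<Rightarrow> 'k alg2" where "elem_d \<eta> = plane_Y \<eta> \<otimes>\<^sub>2[\<eta>] plane_Y \<eta>"

text \<open>
  As \<open>a\<close>, \<open>b\<close>, \<open>c\<close>, \<open>d\<close> are linearly independent, the four values determine exactly one linear
  map on their span; the choice operator only fixes irrelevant values outside that span.
\<close>

definition is_coproduct :: "'k::field \<Rightarrow> ('k alg2 \<Rightarrow> 'k alg4) \<Rightarrow> bool" where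
  "is_coproduct \<eta> D \<longleftrightarrow>
    (let a = elem_a \<eta>; b = elem_b \<eta>; c = elem_c \<eta>; d = elem_d \<eta> in
      linear_on (plane2 \<eta>) (plane4 \<eta>) (genmodule (plane2 \<eta>) {a, b, c, d}) D \<and>
      D a = (a \<otimes>\<^sub>4[\<eta>] a) \<oplus>\<^bsub>plane4 \<eta>\<^esub> (b \<otimes>\<^sub>4[\<eta>] c) \<and>
      D b = (a \<otimes>\<^sub>4[\<eta>] b) \<oplus>\<^bsub>plane4 \<eta>\<^esub> (b \<otimes>\<^sub>4[\<eta>] d) \<and>
      D c = (d \<otimes>\<^sub>4[\<eta>] c) \<oplus>\<^bsub>plane4 \<eta>\<^esub> (c \<otimes>\<^sub>4[\<eta>] a) \<and>
      D d = (d \<otimes>\<^sub>4[\<eta>] d) \<oplus>\<^bsub>plane4 \<eta>\<^esub> (c \<otimes>\<^sub>4[\<eta>] b))"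

definition coproduct :: "'k::field \<Rightarrow> 'k alg2 \<Rightarrow> 'k alg4" where
  "coproduct \<eta> = (SOME D. is_coproduct \<eta> D)"

text \<open>
  Pure tensors span, so the bilinear map is unique on the carriers; the choice operator again
  only fixes values outside of them.
\<close>

definition is_square :: "'k::field \<Rightarrow> ('k alg2 \<Rightarrow> 'k alg2 \<Rightarrow> 'k alg4) \<Rightarrow> bool" where
  "is_square \<eta> f \<longleftrightarrow> bilinear_map (plane2 \<eta>) (plane2 \<eta>) (plane4 \<eta>) f \<and>
    (\<forall>y1\<in>carrier (plane \<eta>). \<forall>y2\<in>carrier (plane \<eta>). \<forall>y3\<in>carrier (plane \<eta>). \<forall>y4\<in>carrier (plane \<eta>).
      f (y1 \<otimes>\<^sub>2[\<eta>] y2) (y3 \<otimes>\<^sub>2[\<eta>] y4) = (y1 \<otimes>\<^sub>2[\<eta>] y3) \<otimes>\<^sub>4[\<eta>] (y2 \<otimes>\<^sub>2[\<eta>] y4))"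

definition square :: "'k::field \<Rightarrow> 'k alg2 \<Rightarrow> 'k alg2 \<Rightarrow> 'k alg4" where
  "square \<eta> = (SOME f. is_square \<eta> f)"

definition bracket :: "'k::field \<Rightarrow> 'k alg2 \<times> 'k alg2 \<Rightarrow> 'k alg2 \<times> 'k alg2 \<Rightarrow> 'k alg4" where
  "bracket \<eta> z w = square \<eta> (fst z) (fst w) \<oplus>\<^bsub>plane4 \<eta>\<^esub> square \<eta> (snd z) (snd w)"

definition per :: "'k::field \<Rightarrow> 'k alg2 \<times> 'k alg2 \<Rightarrow> 'k alg2 \<times> 'k alg2 \<Rightarrow> 'k alg4" where
  "per \<eta> z w = square \<eta> (fst z) (snd w) \<oplus>\<^bsub>plane4 \<eta>\<^esub> square \<eta> (snd z) (fst w)"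

fun DeltaM :: "'k::field \<Rightarrow> gen \<Rightarrow> 'k alg2 \<times> 'k alg2" where
  "DeltaM \<eta> GenX = (plane_X \<eta> \<otimes>\<^sub>2[\<eta>] plane_X \<eta>, plane_X \<eta> \<otimes>\<^sub>2[\<eta>] plane_Y \<eta>)"
| "DeltaM \<eta> GenY = (plane_Y \<eta> \<otimes>\<^sub>2[\<eta>] plane_Y \<eta>, plane_Y \<eta> \<otimes>\<^sub>2[\<eta>] plane_X \<eta>)"

fun DeltaM_tilde :: "'k::field \<Rightarrow> gen \<Rightarrow> 'k alg2 \<times> 'k alg2" where
  "DeltaM_tilde \<eta> GenX = (plane_X \<eta> \<otimes>\<^sub>2[\<eta>] plane_X \<eta>, plane_Y \<eta> \<otimes>\<^sub>2[\<eta>] plane_X \<eta>)"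
| "DeltaM_tilde \<eta> GenY = (plane_Y \<eta> \<otimes>\<^sub>2[\<eta>] plane_Y \<eta>, plane_X \<eta> \<otimes>\<^sub>2[\<eta>] plane_Y \<eta>)"

end

theory Submission
  imports Defs
begin

text \<open>
  Evaluating both sides on pure tensors of the generators gives the same expressions: for example
  \<open>(X \<otimes> Y) \<box> (Y \<otimes> X) = (X \<otimes> Y) \<otimes> (Y \<otimes> X) = b \<otimes> c\<close>, so the second summand of the bracket for
  \<open>X\<close> is the second summand of \<open>\<Delta>(a)\<close>, and likewise for the other seven terms.  The content
  is that the two maps involved exist.  Both \<^const>\<open>square\<close> and \<^const>\<open>coproduct\<close> are chosen by
  a description of some of their values, and a choice satisfies its description only if some map
  does.

  The square is the interchange of the two middle tensor factors.  It is obtained by applying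
  the universal property of the tensor product twice: for fixed third and fourth factor the
  expression \<open>(y\<^sub>1 \<otimes> y\<^sub>3) \<otimes> (y\<^sub>2 \<otimes> y\<^sub>4)\<close> is bilinear in \<open>y\<^sub>1\<close>, \<open>y\<^sub>2\<close>, hence lifts to a linear map of
  \<open>z\<close>; because lifting depends linearly on the bilinear map (linear maps that agree on pure tensors
  are equal), the result is bilinear in \<open>y\<^sub>3\<close>, \<open>y\<^sub>4\<close> for each fixed \<open>z\<close> and lifts once more.

  The coproduct is prescribed on \<open>a\<close>, \<open>b\<close>, \<open>c\<close>, \<open>d\<close>, so it exists once these four are linearly
  independent.  The relation \<open>XY = \<eta> YX\<close> involves only words of length two, so the coefficients of
  the one-letter words \<open>X\<close> and \<open>Y\<close> in a noncommutative polynomial vanish on the ideal that it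
  generates and descend to linear functionals on the algebra, dual to the generators.  Their tensor
  products are functionals dual to \<open>a\<close>, \<open>b\<close>, \<open>c\<close>, \<open>d\<close>, from which a linear map with any
  prescribed values on these elements can be written down.
\<close>

section \<open>Linear maps\<close>

lemma scalars_simps [simp]:
  "carrier (scalars :: 'k::field ring) = UNIV"
  "x \<oplus>\<^bsub>(scalars :: 'k ring)\<^esub> y = x + y"
  "x \<otimes>\<^bsub>(scalars :: 'k ring)\<^esub> y = x * y"
  "\<zero>\<^bsub>(scalars :: 'k ring)\<^esub> = 0"
  "\<one>\<^bsub>(scalars :: 'k ring)\<^esub> = 1"
  by (simp_all add: ring_of_type_algebra_def)

lemma linear_on_closed: "linear_on M P V f \<Longrightarrow> x \<in> V \<Longrightarrow> f x \<in> carrier P"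
  by (auto simp: linear_on_def)

lemma linear_on_add:
  "linear_on M P V f \<Longrightarrow> x \<in> V \<Longrightarrow> y \<in> V \<Longrightarrow> f (x \<oplus>\<^bsub>M\<^esub> y) = f x \<oplus>\<^bsub>P\<^esub> f y"
  by (auto simp: linear_on_def)

lemma linear_on_smult: "linear_on M P V f \<Longrightarrow> x \<in> V \<Longrightarrow> f (c \<odot>\<^bsub>M\<^esub> x) = c \<odot>\<^bsub>P\<^esub> f x"
  by (auto simp: linear_on_def)

lemma linear_on_subset: "linear_on M P W f \<Longrightarrow> V \<subseteq> W \<Longrightarrow> linear_on M P V f"
  unfolding linear_on_def by blast

lemma linear_on_zero:
  assumes "module scalars M" "module scalars P" "linear_on M P (carrier M) f"
  shows "f \<zero>\<^bsub>M\<^esub> = \<zero>\<^bsub>P\<^esub>"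
proof -
  interpret M: module scalars M by fact
  interpret P: module scalars P by fact
  have "f (0 \<odot>\<^bsub>M\<^esub> \<zero>\<^bsub>M\<^esub>) = 0 \<odot>\<^bsub>P\<^esub> f \<zero>\<^bsub>M\<^esub>"
    by (rule linear_on_smult [OF assms(3)]) simp
  then show ?thesis
    using M.smult_l_null P.smult_l_null linear_on_closed [OF assms(3)] by simp
qed

lemma linear_on_pointwise_add:
  assumes "module scalars P" "linear_on M P V f" "linear_on M P V g"
  shows "linear_on M P V (\<lambda>x. f x \<oplus>\<^bsub>P\<^esub> g x)"
proof -
  interpret P: module scalars P by fact
  note closed = linear_on_closed [OF assms(2)] linear_on_closed [OF assms(3)]
  show ?thesis
    unfolding linear_on_def
    by (auto simp: closed linear_on_add [OF assms(2)] linear_on_add [OF assms(3)] P.a_ac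
        linear_on_smult [OF assms(2)] linear_on_smult [OF assms(3)] P.smult_r_distr)
qed

lemma linear_on_pointwise_smult:
  assumes "module scalars P" "linear_on M P V f"
  shows "linear_on M P V (\<lambda>x. c \<odot>\<^bsub>P\<^esub> f x)"
proof -
  interpret P: module scalars P by fact
  note closed = linear_on_closed [OF assms(2)]
  show ?thesis
    unfolding linear_on_def
    by (auto simp: closed linear_on_add [OF assms(2)] linear_on_smult [OF assms(2)] P.smult_r_distr
        P.smult_assoc1 [symmetric, simplified] mult.commute)
qed

lemma linear_on_compose:
  assumes "linear_on M N V f" "linear_on N P (carrier N) g"
  shows "linear_on M P V (\<lambda>x. g (f x))"
  using assms by (auto simp: linear_on_def Pi_iff)

text \<open>
  The field as a module over itself, so that linear functionals are an instance of \<^const>\<open>linear_on\<close>.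
\<close>

definition ground_module :: "('k::field, 'k) module" where
  "ground_module =
    \<lparr>carrier = UNIV, monoid.mult = (*), one = 1, zero = 0, add = (+), module.smult = (*)\<rparr>"

lemma ground_module_simps [simp]:
  "carrier ground_module = UNIV" "x \<oplus>\<^bsub>ground_module\<^esub> y = x + y"
  "c \<odot>\<^bsub>ground_module\<^esub> x = c * x" "\<zero>\<^bsub>ground_module\<^esub> = 0"
  by (simp_all add: ground_module_def)

lemma module_ground_module: "module scalars (ground_module :: ('k::field, 'k) module)"
proof (rule moduleI)
  show "abelian_group (ground_module :: ('k, 'k) module)"
    by (rule abelian_groupI) (auto simp: ac_simps intro: exI [of _ "- _"])
qed (auto simp: algebra_simps)

lemma linear_on_functional_smult:
  assumes "module scalars P" "linear_on M ground_module V \<phi>" "v \<in> carrier P"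
  shows "linear_on M P V (\<lambda>x. \<phi> x \<odot>\<^bsub>P\<^esub> v)"
proof -
  interpret P: module scalars P by fact
  show ?thesis
    unfolding linear_on_def
    by (auto simp: assms(3) linear_on_add [OF assms(2)] linear_on_smult [OF assms(2)]
        P.smult_l_distr [simplified] P.smult_assoc1 [simplified])
qed

section \<open>Submodules and quotients\<close>

lemma genmodule_submodule:
  assumes "module scalars M" "S \<subseteq> carrier M"
  shows "submodule (genmodule M S) scalars M"
proof -
  interpret M: module scalars M by fact
  have "submodule (carrier M) scalars M" by (rule M.carrier_is_submodule)
  then have sub: "genmodule M S \<subseteq> carrier M"
    using assms(2) unfolding genmodule_def by blast
  show ?thesis
  proof (rule M.submoduleI [OF sub])
    show "\<zero>\<^bsub>M\<^esub> \<in> genmodule M S"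
      using subgroup.one_closed submodule.axioms(1) unfolding genmodule_def by fastforce
  qed (auto simp: genmodule_def M.submoduleE)
qed

lemma genmodule_superset: "S \<subseteq> genmodule M S"
  unfolding genmodule_def by blast

lemma genmodule_least: "submodule H scalars M \<Longrightarrow> S \<subseteq> H \<Longrightarrow> genmodule M S \<subseteq> H"
  unfolding genmodule_def by blast

lemma submodule_kernel:
  assumes "module scalars M" "module scalars P" "linear_on M P (carrier M) f"
  shows "submodule {x \<in> carrier M. f x = \<zero>\<^bsub>P\<^esub>} scalars M"
proof -
  interpret M: module scalars M by fact
  interpret P: module scalars P by fact
  note lin = linear_on_add [OF assms(3)] linear_on_smult [OF assms(3)] linear_on_zero [OF assms]
  show ?thesis
  proof (rule M.submoduleI)
    fix a assume a: "a \<in> {x \<in> carrier M. f x = \<zero>\<^bsub>P\<^esub>}"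
    then have "f (\<ominus>\<^bsub>M\<^esub> a) = f (\<ominus>\<^bsub>M\<^esub> a) \<oplus>\<^bsub>P\<^esub> f a"
      using linear_on_closed [OF assms(3)] by simp
    also have "\<dots> = f (\<ominus>\<^bsub>M\<^esub> a \<oplus>\<^bsub>M\<^esub> a)"
      using a lin by simp
    also have "\<dots> = \<zero>\<^bsub>P\<^esub>"
      using a lin M.M.l_neg by simp
    finally show "\<ominus>\<^bsub>M\<^esub> a \<in> {x \<in> carrier M. f x = \<zero>\<^bsub>P\<^esub>}"
      using a by simp
  qed (auto simp: lin P.smult_r_null)
qed

lemma FactModule_simps [simp]:
  "carrier (FactModule M N) = a_rcosets\<^bsub>M\<^esub> N"
  "x \<oplus>\<^bsub>FactModule M N\<^esub> y = set_add M x y"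
  "\<zero>\<^bsub>FactModule M N\<^esub> = N"
  by (simp_all add: FactModule_def)

locale quotient_module =
  fixes M :: "('k::field, 'v) module" and N :: "'v set"
  assumes module: "module scalars M" and submodule: "submodule N scalars M"
begin

sublocale module scalars M
  by (rule module)

sublocale sub: abelian_subgroup N M
  by (rule abelian_subgroupI3 [OF additive_subgroupI [OF submodule.axioms(1) [OF submodule]]]) unfold_locales

lemma coset_add:
  "x \<in> carrier M \<Longrightarrow> y \<in> carrier M \<Longrightarrow>
    (N +>\<^bsub>M\<^esub> x) \<oplus>\<^bsub>FactModule M N\<^esub> (N +>\<^bsub>M\<^esub> y) = N +>\<^bsub>M\<^esub> (x \<oplus>\<^bsub>M\<^esub> y)"
  by (simp add: sub.a_rcos_sum)

lemma coset_mem_iff: "y \<in> N +>\<^bsub>M\<^esub> x \<longleftrightarrow> (\<exists>n\<in>N. y = n \<oplus>\<^bsub>M\<^esub> x)"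
  by (auto simp: a_r_coset_def')

lemma coset_eqI:
  "x \<in> carrier M \<Longrightarrow> y \<in> N +>\<^bsub>M\<^esub> x \<Longrightarrow> N +>\<^bsub>M\<^esub> y = N +>\<^bsub>M\<^esub> x"
  by (rule a_repr_independence [OF _ _ sub.a_subgroup, symmetric])

lemma coset_self: "x \<in> carrier M \<Longrightarrow> x \<in> N +>\<^bsub>M\<^esub> x"
  unfolding coset_mem_iff
  by (rule bexI [of _ "\<zero>\<^bsub>M\<^esub>"]) (simp_all only: M.l_zero sub.zero_closed)

lemma coset_smult:
  assumes x: "x \<in> carrier M"
  shows "c \<odot>\<^bsub>FactModule M N\<^esub> (N +>\<^bsub>M\<^esub> x) = N +>\<^bsub>M\<^esub> (c \<odot>\<^bsub>M\<^esub> x)"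
proof -
  have cx: "c \<odot>\<^bsub>M\<^esub> x \<in> carrier M"
    using x by (intro smult_closed) (simp_all only: scalars_simps UNIV_I)
  have "N +>\<^bsub>M\<^esub> (c \<odot>\<^bsub>M\<^esub> y) = N +>\<^bsub>M\<^esub> (c \<odot>\<^bsub>M\<^esub> x)" if y: "y \<in> N +>\<^bsub>M\<^esub> x" for y
  proof -
    obtain n where n: "n \<in> N" "y = n \<oplus>\<^bsub>M\<^esub> x"
      using y unfolding coset_mem_iff by blast
    have "n \<in> carrier M"
      using n sub.a_subset by blast
    then have "c \<odot>\<^bsub>M\<^esub> y = c \<odot>\<^bsub>M\<^esub> n \<oplus>\<^bsub>M\<^esub> c \<odot>\<^bsub>M\<^esub> x"
      unfolding n using x by (simp only: smult_r_distr scalars_simps UNIV_I)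
    moreover have "c \<odot>\<^bsub>M\<^esub> n \<in> N"
      using submodule.smult_closed [OF submodule _ n(1)] by (simp only: scalars_simps UNIV_I)
    ultimately have "c \<odot>\<^bsub>M\<^esub> y \<in> N +>\<^bsub>M\<^esub> (c \<odot>\<^bsub>M\<^esub> x)"
      unfolding coset_mem_iff by (intro bexI)
    then show ?thesis
      by (rule coset_eqI [OF cx])
  qed
  then have "(\<Union>y\<in>N +>\<^bsub>M\<^esub> x. N +>\<^bsub>M\<^esub> (c \<odot>\<^bsub>M\<^esub> y)) = (\<Union>y\<in>N +>\<^bsub>M\<^esub> x. N +>\<^bsub>M\<^esub> (c \<odot>\<^bsub>M\<^esub> x))"
    by (rule SUP_cong [OF refl])
  also have "\<dots> = N +>\<^bsub>M\<^esub> (c \<odot>\<^bsub>M\<^esub> x)"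
    using coset_self [OF x] by blast
  finally show ?thesis
    by (simp add: FactModule_def)
qed

lemma carrier_quotient: "S \<in> carrier (FactModule M N) \<longleftrightarrow> (\<exists>x\<in>carrier M. S = N +>\<^bsub>M\<^esub> x)"
  by (auto simp: A_RCOSETS_def')

lemma coset_closed: "x \<in> carrier M \<Longrightarrow> N +>\<^bsub>M\<^esub> x \<in> carrier (FactModule M N)"
  unfolding carrier_quotient by blast

lemma coset_zero: "\<zero>\<^bsub>FactModule M N\<^esub> = N +>\<^bsub>M\<^esub> \<zero>\<^bsub>M\<^esub>"
  by (simp add: sub.a_subset)

lemma module_FactModule: "module scalars (FactModule M N)"
proof (rule moduleI)
  let ?Q = "FactModule M N"
  show "cring (scalars :: 'k ring)" ..
  show "abelian_group ?Q"
  proof (rule abelian_groupI)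
    fix S T assume "S \<in> carrier ?Q" "T \<in> carrier ?Q"
    then obtain x y where x: "x \<in> carrier M" "S = N +>\<^bsub>M\<^esub> x" and y: "y \<in> carrier M" "T = N +>\<^bsub>M\<^esub> y"
      unfolding carrier_quotient by blast
    show "S \<oplus>\<^bsub>?Q\<^esub> T \<in> carrier ?Q"
      unfolding x y by (simp only: x y coset_add coset_closed M.a_closed)
    show "S \<oplus>\<^bsub>?Q\<^esub> T = T \<oplus>\<^bsub>?Q\<^esub> S"
      unfolding x y by (simp only: x y coset_add M.a_comm [of x y])
    fix U assume "U \<in> carrier ?Q"
    then obtain z where z: "z \<in> carrier M" "U = N +>\<^bsub>M\<^esub> z"
      unfolding carrier_quotient by blast
    show "S \<oplus>\<^bsub>?Q\<^esub> T \<oplus>\<^bsub>?Q\<^esub> U = S \<oplus>\<^bsub>?Q\<^esub> (T \<oplus>\<^bsub>?Q\<^esub> U)"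
      unfolding x y z by (simp only: x y z coset_add M.a_closed M.a_assoc)
  next
    show "\<zero>\<^bsub>?Q\<^esub> \<in> carrier ?Q"
      unfolding coset_zero by (simp only: coset_closed M.zero_closed)
    fix S assume "S \<in> carrier ?Q"
    then obtain x where x: "x \<in> carrier M" "S = N +>\<^bsub>M\<^esub> x"
      unfolding carrier_quotient by blast
    show "\<zero>\<^bsub>?Q\<^esub> \<oplus>\<^bsub>?Q\<^esub> S = S"
      unfolding coset_zero x by (simp only: x coset_add M.zero_closed M.l_zero)
    show "\<exists>T\<in>carrier ?Q. T \<oplus>\<^bsub>?Q\<^esub> S = \<zero>\<^bsub>?Q\<^esub>"
      unfolding coset_zero x
      by (rule bexI [of _ "N +>\<^bsub>M\<^esub> (\<ominus>\<^bsub>M\<^esub> x)"])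
        (simp_all only: x coset_add coset_closed M.a_inv_closed M.l_neg)
  qed
  fix c d :: 'k and S assume "S \<in> carrier ?Q"
  then obtain x where x: "x \<in> carrier M" "S = N +>\<^bsub>M\<^esub> x"
    unfolding carrier_quotient by blast
  have closed: "e \<odot>\<^bsub>M\<^esub> x \<in> carrier M" for e
    using x by simp
  show "c \<odot>\<^bsub>?Q\<^esub> S \<in> carrier ?Q"
    unfolding x by (simp only: x coset_smult coset_closed closed)
  show "(c \<oplus>\<^bsub>scalars\<^esub> d) \<odot>\<^bsub>?Q\<^esub> S = c \<odot>\<^bsub>?Q\<^esub> S \<oplus>\<^bsub>?Q\<^esub> d \<odot>\<^bsub>?Q\<^esub> S"
    unfolding x by (simp only: x coset_smult coset_add closed smult_l_distr scalars_simps UNIV_I)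
      (simp add: smult_l_distr [simplified] x)
  show "(c \<otimes>\<^bsub>scalars\<^esub> d) \<odot>\<^bsub>?Q\<^esub> S = c \<odot>\<^bsub>?Q\<^esub> (d \<odot>\<^bsub>?Q\<^esub> S)"
    unfolding x by (simp only: x coset_smult closed) (simp add: smult_assoc1 [simplified] x)
  show "\<one>\<^bsub>scalars\<^esub> \<odot>\<^bsub>?Q\<^esub> S = S"
    unfolding x using smult_one [OF x(1)] by (simp only: x coset_smult)
  fix T assume "T \<in> carrier ?Q"
  then obtain y where y: "y \<in> carrier M" "T = N +>\<^bsub>M\<^esub> y"
    unfolding carrier_quotient by blast
  show "c \<odot>\<^bsub>?Q\<^esub> (S \<oplus>\<^bsub>?Q\<^esub> T) = c \<odot>\<^bsub>?Q\<^esub> S \<oplus>\<^bsub>?Q\<^esub> c \<odot>\<^bsub>?Q\<^esub> T"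
    unfolding x y using x y by (simp only: coset_smult coset_add M.a_closed closed smult_closed
        scalars_simps UNIV_I smult_r_distr)
qed

lemma linear_on_coset: "linear_on M (FactModule M N) (carrier M) (\<lambda>x. N +>\<^bsub>M\<^esub> x)"
  unfolding linear_on_def by (auto simp only: coset_add coset_smult coset_closed)

text \<open>
  A linear map that vanishes on \<open>N\<close> takes a single value on each coset, so evaluating it at an
  arbitrary representative descends to the quotient.
\<close>

lemma linear_on_factor:
  assumes P: "module scalars P" and f: "linear_on M P (carrier M) f"
    and vanish: "\<And>n. n \<in> N \<Longrightarrow> f n = \<zero>\<^bsub>P\<^esub>"
  obtains g where "linear_on (FactModule M N) P (carrier (FactModule M N)) g"
    and "\<And>x. x \<in> carrier M \<Longrightarrow> g (N +>\<^bsub>M\<^esub> x) = f x"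
proof
  interpret P: module scalars P by fact
  define g where "g = (\<lambda>S. f (SOME x. x \<in> S))"
  show g: "g (N +>\<^bsub>M\<^esub> x) = f x" if x: "x \<in> carrier M" for x
  proof -
    have "(SOME y. y \<in> N +>\<^bsub>M\<^esub> x) \<in> N +>\<^bsub>M\<^esub> x"
      using coset_self [OF x] by (rule someI)
    then obtain n where n: "n \<in> N" "(SOME y. y \<in> N +>\<^bsub>M\<^esub> x) = n \<oplus>\<^bsub>M\<^esub> x"
      unfolding coset_mem_iff by blast
    moreover have "n \<in> carrier M"
      using n sub.a_subset by blast
    ultimately show ?thesis
      using x linear_on_closed [OF f x] by (simp add: g_def linear_on_add [OF f] vanish)
  qed
  show "linear_on (FactModule M N) P (carrier (FactModule M N)) g"
    unfolding linear_on_def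
    by (auto simp only: carrier_quotient coset_add coset_smult g linear_on_closed [OF f]
        linear_on_add [OF f] linear_on_smult [OF f] a_closed smult_closed scalars_simps UNIV_I Pi_iff)
qed

end

section \<open>Finitely supported functions\<close>

lemma lookup_map_times [simp]:
  "Poly_Mapping.lookup (Poly_Mapping.map ((*) c) p) x = c * Poly_Mapping.lookup p x" for c :: "'k::field"
  by (auto simp: Poly_Mapping.map.rep_eq when_def)

text \<open>
  Unlike \<open>update_induct\<close>, the step adds a monomial, whether or not it already occurs, so that
  additive statements need no reasoning about supports.
\<close>

lemma poly_mapping_single_add_induct [case_names zero add]:
  fixes p :: "'a \<Rightarrow>\<^sub>0 'b::comm_monoid_add"
  assumes "P 0" and "\<And>p x c. P p \<Longrightarrow> P (p + Poly_Mapping.single x c)"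
  shows "P p"
proof (induction p rule: update_induct)
  case (update p x c)
  have "Poly_Mapping.update x c p = p + Poly_Mapping.single x c"
    using update(1)
    by (intro poly_mapping_eqI) (auto simp: lookup_update lookup_add lookup_single in_keys_iff)
  then show ?case
    using assms(2) update by simp
qed (rule assms(1))

text \<open>
  Scaling is multiplication by a multiple of the unit, which is why ideals of a monoid algebra
  are closed under it.
\<close>

lemma map_times_eq_single_mult:
  "Poly_Mapping.map ((*) c) p = Poly_Mapping.single 0 c * (p :: 'a::monoid_add \<Rightarrow>\<^sub>0 'k::field)"
proof (induction p rule: poly_mapping_single_add_induct)
  case zero
  then show ?case
    by (intro poly_mapping_eqI) simp
next
  case (add p a b)
  have "Poly_Mapping.map ((*) c) (p + Poly_Mapping.single a b) =
      Poly_Mapping.map ((*) c) p + Poly_Mapping.single a (c * b)"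
    by (intro poly_mapping_eqI) (auto simp: lookup_add lookup_single when_def algebra_simps)
  then show ?case
    by (simp add: add distrib_left mult_single)
qed

section \<open>The universal property of the tensor product\<close>

lemma free_on_pairs_simps [simp]:
  "carrier (free_on_pairs M N) = {p. Poly_Mapping.keys p \<subseteq> carrier M \<times> carrier N}"
  "p \<oplus>\<^bsub>free_on_pairs M N\<^esub> q = p + q"
  "\<zero>\<^bsub>free_on_pairs M N\<^esub> = 0"
  "c \<odot>\<^bsub>free_on_pairs M N\<^esub> p = Poly_Mapping.map ((*) c) p"
  by (simp_all add: free_on_pairs_def)

lemma keys_map_times_subset: "Poly_Mapping.keys (Poly_Mapping.map ((*) c) p) \<subseteq> Poly_Mapping.keys p"
  for c :: "'k::field"
  by (auto simp: in_keys_iff)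

lemma module_free_on_pairs: "module scalars (free_on_pairs M N)"
proof (rule moduleI)
  show "cring (scalars :: 'a ring)" ..
  show "abelian_group (free_on_pairs M N)"
  proof (rule abelian_groupI)
    fix p q assume "p \<in> carrier (free_on_pairs M N)" "q \<in> carrier (free_on_pairs M N)"
    then show "p \<oplus>\<^bsub>free_on_pairs M N\<^esub> q \<in> carrier (free_on_pairs M N)"
      using keys_add [of p q] by auto
  next
    fix p assume "p \<in> carrier (free_on_pairs M N)"
    then show "\<exists>q\<in>carrier (free_on_pairs M N). q \<oplus>\<^bsub>free_on_pairs M N\<^esub> p = \<zero>\<^bsub>free_on_pairs M N\<^esub>"
      by (intro bexI [of _ "- p"]) auto
  qed (auto simp: ac_simps)
next
  fix c p assume "p \<in> carrier (free_on_pairs M N)"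
  then show "c \<odot>\<^bsub>free_on_pairs M N\<^esub> p \<in> carrier (free_on_pairs M N)"
    using keys_map_times_subset [of c p] by auto
qed (auto intro!: poly_mapping_eqI simp: lookup_add algebra_simps)

text \<open>
  The pairs \<open>(x, y)\<close> form a generating set, which determines linear maps.
\<close>

lemma free_on_pairs_linear_eqI:
  assumes P: "module scalars P"
    and f: "linear_on (free_on_pairs M N) P (carrier (free_on_pairs M N)) f"
    and g: "linear_on (free_on_pairs M N) P (carrier (free_on_pairs M N)) g"
    and basis: "\<And>x y. x \<in> carrier M \<Longrightarrow> y \<in> carrier N \<Longrightarrow>
      f (Poly_Mapping.single (x, y) 1) = g (Poly_Mapping.single (x, y) 1)"
    and p: "p \<in> carrier (free_on_pairs M N)"
  shows "f p = g p"
  using p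
proof (induction p rule: update_induct)
  case const
  then show ?case
    using linear_on_zero [OF module_free_on_pairs P f] linear_on_zero [OF module_free_on_pairs P g]
    by simp
next
  case (update p k c)
  have eq: "Poly_Mapping.update k c p = p + Poly_Mapping.map ((*) c) (Poly_Mapping.single k 1)"
    using update(1) by (intro poly_mapping_eqI) (auto simp: lookup_update lookup_add lookup_single in_keys_iff)
  have keys: "Poly_Mapping.keys (Poly_Mapping.update k c p) = insert k (Poly_Mapping.keys p)"
    using update(2) by (auto simp: in_keys_iff lookup_update split: if_splits)
  have k: "k \<in> carrier M \<times> carrier N" and p: "p \<in> carrier (free_on_pairs M N)"
    using update.prems keys by auto
  have s: "Poly_Mapping.single k 1 \<in> carrier (free_on_pairs M N)"
    using k by auto
  have cs: "Poly_Mapping.map ((*) c) (Poly_Mapping.single k 1) \<in> carrier (free_on_pairs M N)"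
    using s keys_map_times_subset [of c "Poly_Mapping.single k 1"] by auto
  have "f (Poly_Mapping.single k 1) = g (Poly_Mapping.single k 1)"
    using k basis by (cases k) auto
  then show ?case
    unfolding eq using linear_on_add [OF f p cs] linear_on_add [OF g p cs]
      linear_on_smult [OF f s, of c] linear_on_smult [OF g s, of c] update.IH [OF p] by simp
qed

text \<open>
  The pairs form a basis, so values on them can be prescribed freely.  The extension sums over the
  support of its argument; linearity follows after enlarging the supports involved to a common
  finite set, on which the additional terms are zero.
\<close>

lemma free_on_pairs_extend:
  assumes P: "module scalars P"
    and B: "\<And>x y. x \<in> carrier M \<Longrightarrow> y \<in> carrier N \<Longrightarrow> B x y \<in> carrier P"
  obtains f where "linear_on (free_on_pairs M N) P (carrier (free_on_pairs M N)) f"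
    and "\<And>x y c. x \<in> carrier M \<Longrightarrow> y \<in> carrier N \<Longrightarrow>
      f (Poly_Mapping.single (x, y) c) = c \<odot>\<^bsub>P\<^esub> B x y"
proof
  interpret P: module scalars P by fact
  define t where "t = (\<lambda>p (x, y). Poly_Mapping.lookup p (x, y) \<odot>\<^bsub>P\<^esub> B x y)"
  define f where "f = (\<lambda>p. finsum P (t p) (Poly_Mapping.keys p))"
  have t: "t p k \<in> carrier P" if "k \<in> carrier M \<times> carrier N" for p k
    using that B by (auto simp: t_def)
  have t0: "t p k = \<zero>\<^bsub>P\<^esub>" if "k \<notin> Poly_Mapping.keys p" "k \<in> carrier M \<times> carrier N" for p k
    using that B P.smult_l_null by (auto simp: t_def in_keys_iff)
  have f_eq: "f p = finsum P (t p) K"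
    if "finite K" "Poly_Mapping.keys p \<subseteq> K" "K \<subseteq> carrier M \<times> carrier N" for p K
    unfolding f_def
  proof (rule P.add.finprod_mono_neutral_cong_left)
    show "t p \<in> K \<rightarrow> carrier P"
      using that t by blast
  qed (use that t0 in auto)
  show "linear_on (free_on_pairs M N) P (carrier (free_on_pairs M N)) f"
    unfolding linear_on_def
  proof (intro conjI ballI allI)
    show "f \<in> carrier (free_on_pairs M N) \<rightarrow> carrier P"
      unfolding f_def using t by (auto intro!: P.M.finsum_closed)
  next
    fix p q assume p: "p \<in> carrier (free_on_pairs M N)" and q: "q \<in> carrier (free_on_pairs M N)"
    define K where "K = Poly_Mapping.keys p \<union> Poly_Mapping.keys q"
    have K: "finite K" "K \<subseteq> carrier M \<times> carrier N" "Poly_Mapping.keys (p + q) \<subseteq> K"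
      using p q keys_add [of p q] by (auto simp: K_def)
    then have tK: "t p \<in> K \<rightarrow> carrier P" for p
      using t by blast
    have "f (p + q) = finsum P (t (p + q)) K"
      using K by (intro f_eq)
    also have "\<dots> = finsum P (\<lambda>k. t p k \<oplus>\<^bsub>P\<^esub> t q k) K"
    proof (rule P.M.finsum_cong')
      show "t (p + q) k = t p k \<oplus>\<^bsub>P\<^esub> t q k" if "k \<in> K" for k
        using that K(2) B by (auto simp: t_def lookup_add P.smult_l_distr [simplified])
    qed (use tK in auto)
    also have "\<dots> = finsum P (t p) K \<oplus>\<^bsub>P\<^esub> finsum P (t q) K"
      by (rule P.M.finsum_addf [OF tK tK])
    also have "\<dots> = f p \<oplus>\<^bsub>P\<^esub> f q"
      by (subst (1 2) f_eq [OF K(1) _ K(2)]) (auto simp: K_def)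
    finally show "f (p \<oplus>\<^bsub>free_on_pairs M N\<^esub> q) = f p \<oplus>\<^bsub>P\<^esub> f q"
      by simp
  next
    fix c p assume p: "p \<in> carrier (free_on_pairs M N)"
    define K where "K = Poly_Mapping.keys p"
    have K: "finite K" "K \<subseteq> carrier M \<times> carrier N" "Poly_Mapping.keys (Poly_Mapping.map ((*) c) p) \<subseteq> K"
      using p keys_map_times_subset [of c p] by (auto simp: K_def)
    then have tK: "t p \<in> K \<rightarrow> carrier P" for p
      using t by blast
    have "f (Poly_Mapping.map ((*) c) p) = finsum P (t (Poly_Mapping.map ((*) c) p)) K"
      using K by (intro f_eq)
    also have "\<dots> = finsum P (\<lambda>k. c \<odot>\<^bsub>P\<^esub> t p k) K"
    proof (rule P.M.finsum_cong')
      show "t (Poly_Mapping.map ((*) c) p) k = c \<odot>\<^bsub>P\<^esub> t p k" if "k \<in> K" for k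
        using that K(2) B by (auto simp: t_def P.smult_assoc1 [simplified])
      show "(\<lambda>k. c \<odot>\<^bsub>P\<^esub> t p k) \<in> K \<rightarrow> carrier P"
        using P.smult_closed tK [of p] by (simp add: Pi_iff)
    qed simp
    also have "\<dots> = c \<odot>\<^bsub>P\<^esub> f p"
      using P.finsum_smult_ldistr [OF K(1) _ tK, of c p] by (simp add: f_def K_def)
    finally show "f (c \<odot>\<^bsub>free_on_pairs M N\<^esub> p) = c \<odot>\<^bsub>P\<^esub> f p"
      by simp
  qed
  fix x y and c :: 'a assume xy: "x \<in> carrier M" "y \<in> carrier N"
  have "f (Poly_Mapping.single (x, y) c) = finsum P (t (Poly_Mapping.single (x, y) c)) {(x, y)}"
    using xy by (intro f_eq) auto
  then show "f (Poly_Mapping.single (x, y) c) = c \<odot>\<^bsub>P\<^esub> B x y"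
    using xy B by (simp add: t_def)
qed

lemma tensor_relations_subset:
  assumes "module scalars M" "module scalars N"
  shows "tensor_relations M N \<subseteq> carrier (free_on_pairs M N)"
proof -
  interpret M: module scalars M by fact
  interpret N: module scalars N by fact
  have minus: "p - q \<in> carrier (free_on_pairs M N)"
    if "p \<in> carrier (free_on_pairs M N)" "q \<in> carrier (free_on_pairs M N)" for p q
    using that keys_diff [of p q] by auto
  have single: "Poly_Mapping.single (x, y) c \<in> carrier (free_on_pairs M N)"
    if "x \<in> carrier M" "y \<in> carrier N" for x y c
    using that by auto
  show ?thesis
    unfolding tensor_relations_def by (auto simp del: free_on_pairs_simps intro!: minus single)
qed

lemma quotient_module_tensor:
  assumes "module scalars M" "module scalars N"
  shows "quotient_module (free_on_pairs M N) (tensor_null M N)"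
  unfolding tensor_null_def
  by (intro quotient_module.intro module_free_on_pairs genmodule_submodule tensor_relations_subset assms)

lemma module_tensor_product:
  "module scalars M \<Longrightarrow> module scalars N \<Longrightarrow> module scalars (tensor_product M N)"
  unfolding tensor_product_def
  by (intro quotient_module.module_FactModule quotient_module_tensor)

lemma tensor_relations_cases:
  assumes "r \<in> tensor_relations M N"
  obtains (add_left) x x' y where "x \<in> carrier M" "x' \<in> carrier M" "y \<in> carrier N"
      "r = Poly_Mapping.single (x \<oplus>\<^bsub>M\<^esub> x', y) 1 - Poly_Mapping.single (x, y) 1
        - Poly_Mapping.single (x', y) 1"
  | (add_right) x y y' where "x \<in> carrier M" "y \<in> carrier N" "y' \<in> carrier N"
      "r = Poly_Mapping.single (x, y \<oplus>\<^bsub>N\<^esub> y') 1 - Poly_Mapping.single (x, y) 1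
        - Poly_Mapping.single (x, y') 1"
  | (smult_left) c x y where "x \<in> carrier M" "y \<in> carrier N"
      "r = Poly_Mapping.single (c \<odot>\<^bsub>M\<^esub> x, y) 1 - Poly_Mapping.single (x, y) c"
  | (smult_right) c x y where "x \<in> carrier M" "y \<in> carrier N"
      "r = Poly_Mapping.single (x, c \<odot>\<^bsub>N\<^esub> y) 1 - Poly_Mapping.single (x, y) c"
  using assms unfolding tensor_relations_def by blast

text \<open>
  Each of the four identities that make up bilinearity says that two elements of the free module
  have the same coset, and their difference is one of the defining relations.
\<close>

lemma bilinear_map_pure_tensor:
  assumes M: "module scalars M" and N: "module scalars N"
  shows "bilinear_map M N (tensor_product M N) (pure_tensor M N)"
proof -
  interpret M: module scalars M by fact
  interpret N: module scalars N by fact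
  interpret Q: quotient_module "free_on_pairs M N" "tensor_null M N"
    using M N by (rule quotient_module_tensor)
  let ?F = "free_on_pairs M N" and ?s = "\<lambda>x y. Poly_Mapping.single (x, y) 1"
  let ?K = "tensor_null M N"
  have single: "?s x y \<in> carrier ?F" if "x \<in> carrier M" "y \<in> carrier N" for x y
    using that by auto
  have rel: "?K +>\<^bsub>?F\<^esub> p = ?K +>\<^bsub>?F\<^esub> q"
    if "p - q \<in> tensor_relations M N" "q \<in> carrier ?F" for p q
  proof (rule Q.coset_eqI)
    have "p - q \<in> ?K"
      unfolding tensor_null_def by (rule subsetD [OF genmodule_superset that(1)])
    then show "p \<in> ?K +>\<^bsub>?F\<^esub> q"
      unfolding Q.coset_mem_iff by (rule bexI [rotated]) simp
  qed fact
  have plus: "?s x y + ?s x' y' \<in> carrier ?F"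
    if "x \<in> carrier M" "y \<in> carrier N" "x' \<in> carrier M" "y' \<in> carrier N" for x y x' y'
    using Q.M.a_closed [OF single [OF that(1,2)] single [OF that(3,4)]] by simp
  have scaled: "Poly_Mapping.single (x, y) c = c \<odot>\<^bsub>?F\<^esub> ?s x y" for x y c
    by (intro poly_mapping_eqI) (simp add: lookup_single when_def)
  have scaled_closed: "Poly_Mapping.single (x, y) c \<in> carrier ?F"
    if "x \<in> carrier M" "y \<in> carrier N" for x y c
    using that by auto
  have add_eq: "pure_tensor M N x y \<oplus>\<^bsub>tensor_product M N\<^esub> pure_tensor M N x' y' =
      ?K +>\<^bsub>?F\<^esub> (?s x y + ?s x' y')"
    if "x \<in> carrier M" "y \<in> carrier N" "x' \<in> carrier M" "y' \<in> carrier N" for x y x' y'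
    using Q.coset_add [OF single [OF that(1,2)] single [OF that(3,4)]]
    unfolding pure_tensor_def tensor_product_def free_on_pairs_simps(2) .
  have smult_eq: "c \<odot>\<^bsub>tensor_product M N\<^esub> pure_tensor M N x y =
      ?K +>\<^bsub>?F\<^esub> Poly_Mapping.single (x, y) c"
    if "x \<in> carrier M" "y \<in> carrier N" for x y c
    using Q.coset_smult [OF single [OF that], of c]
    unfolding pure_tensor_def tensor_product_def scaled [symmetric] .
  have closed: "pure_tensor M N x y \<in> carrier (tensor_product M N)"
    if "x \<in> carrier M" "y \<in> carrier N" for x y
    using Q.coset_closed [OF single [OF that]] unfolding pure_tensor_def tensor_product_def .
  have "pure_tensor M N (x \<oplus>\<^bsub>M\<^esub> x') y =
      pure_tensor M N x y \<oplus>\<^bsub>tensor_product M N\<^esub> pure_tensor M N x' y"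
    if xy: "x \<in> carrier M" "x' \<in> carrier M" "y \<in> carrier N" for x x' y
    unfolding add_eq [OF xy(1,3,2,3)] unfolding pure_tensor_def
  proof (rule rel)
    show "?s (x \<oplus>\<^bsub>M\<^esub> x') y - (?s x y + ?s x' y) \<in> tensor_relations M N"
      using xy unfolding tensor_relations_def diff_diff_add [symmetric] by blast
  qed (intro plus xy)
  moreover have "pure_tensor M N x (y \<oplus>\<^bsub>N\<^esub> y') =
      pure_tensor M N x y \<oplus>\<^bsub>tensor_product M N\<^esub> pure_tensor M N x y'"
    if xy: "x \<in> carrier M" "y \<in> carrier N" "y' \<in> carrier N" for x y y'
    unfolding add_eq [OF xy(1,2,1,3)] unfolding pure_tensor_def
  proof (rule rel)
    show "?s x (y \<oplus>\<^bsub>N\<^esub> y') - (?s x y + ?s x y') \<in> tensor_relations M N"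
      using xy unfolding tensor_relations_def diff_diff_add [symmetric] by blast
  qed (intro plus xy)
  moreover have "pure_tensor M N (c \<odot>\<^bsub>M\<^esub> x) y = c \<odot>\<^bsub>tensor_product M N\<^esub> pure_tensor M N x y"
    if xy: "x \<in> carrier M" "y \<in> carrier N" for c x y
    unfolding smult_eq [OF xy] unfolding pure_tensor_def
  proof (rule rel)
    show "?s (c \<odot>\<^bsub>M\<^esub> x) y - Poly_Mapping.single (x, y) c \<in> tensor_relations M N"
      using xy unfolding tensor_relations_def by blast
  qed (intro scaled_closed xy)
  moreover have "pure_tensor M N x (c \<odot>\<^bsub>N\<^esub> y) = c \<odot>\<^bsub>tensor_product M N\<^esub> pure_tensor M N x y"
    if xy: "x \<in> carrier M" "y \<in> carrier N" for c x y
    unfolding smult_eq [OF xy] unfolding pure_tensor_def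
  proof (rule rel)
    show "?s x (c \<odot>\<^bsub>N\<^esub> y) - Poly_Mapping.single (x, y) c \<in> tensor_relations M N"
      using xy unfolding tensor_relations_def by blast
  qed (intro scaled_closed xy)
  ultimately show ?thesis
    unfolding bilinear_map_def linear_on_def using closed by simp
qed

lemma pure_tensor_closed:
  assumes "module scalars M" "module scalars N" "x \<in> carrier M" "y \<in> carrier N"
  shows "pure_tensor M N x y \<in> carrier (tensor_product M N)"
  using bilinear_map_pure_tensor [OF assms(1,2)] assms(3,4)
  by (auto simp: bilinear_map_def intro: linear_on_closed)

text \<open>
  Pure tensors generate the tensor product, as the images of the pairs that generate the
  free module.
\<close>

lemma tensor_linear_eqI:
  assumes M: "module scalars M" and N: "module scalars N" and P: "module scalars P"
    and f: "linear_on (tensor_product M N) P (carrier (tensor_product M N)) f"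
    and g: "linear_on (tensor_product M N) P (carrier (tensor_product M N)) g"
    and pure: "\<And>x y. x \<in> carrier M \<Longrightarrow> y \<in> carrier N \<Longrightarrow>
      f (pure_tensor M N x y) = g (pure_tensor M N x y)"
    and z: "z \<in> carrier (tensor_product M N)"
  shows "f z = g z"
proof -
  interpret Q: quotient_module "free_on_pairs M N" "tensor_null M N"
    using M N by (rule quotient_module_tensor)
  obtain p where p: "p \<in> carrier (free_on_pairs M N)"
    and z: "z = tensor_null M N +>\<^bsub>free_on_pairs M N\<^esub> p"
    using z Q.carrier_quotient unfolding tensor_product_def by blast
  note lin = linear_on_compose [OF Q.linear_on_coset, folded tensor_product_def]
  show ?thesis
    unfolding z
    by (rule free_on_pairs_linear_eqI [OF P lin [OF f] lin [OF g] _ p])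
      (fact pure [unfolded pure_tensor_def])
qed

text \<open>
  The linear extension of \<open>B\<close> from pairs to the free module has a submodule as its kernel, and by
  bilinearity this contains the four families of relations; hence it contains the submodule that they
  generate, and the extension factors through the quotient.
\<close>

lemma tensor_lift_exists:
  assumes M: "module scalars M" and N: "module scalars N" and P: "module scalars P"
    and B: "bilinear_map M N P B"
  shows "\<exists>g. linear_on (tensor_product M N) P (carrier (tensor_product M N)) g \<and>
    (\<forall>x\<in>carrier M. \<forall>y\<in>carrier N. g (pure_tensor M N x y) = B x y)"
proof -
  interpret M: module scalars M by fact
  interpret N: module scalars N by fact
  interpret P: module scalars P by fact
  interpret Q: quotient_module "free_on_pairs M N" "tensor_null M N"
    using M N by (rule quotient_module_tensor)
  let ?F = "free_on_pairs M N"
  have right: "linear_on N P (carrier N) (B x)" if "x \<in> carrier M" for x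
    using B that by (simp add: bilinear_map_def)
  have left: "linear_on M P (carrier M) (\<lambda>x. B x y)" if "y \<in> carrier N" for y
    using B that by (simp add: bilinear_map_def)
  have closed: "B x y \<in> carrier P" if "x \<in> carrier M" "y \<in> carrier N" for x y
    using linear_on_closed [OF right] that by blast
  obtain f where f: "linear_on ?F P (carrier ?F) f"
    and f_single: "\<And>x y c. x \<in> carrier M \<Longrightarrow> y \<in> carrier N \<Longrightarrow>
      f (Poly_Mapping.single (x, y) c) = c \<odot>\<^bsub>P\<^esub> B x y"
    using free_on_pairs_extend [where B = B and M = M and N = N, OF P closed] by metis
  have diff: "p - q \<in> carrier ?F" if "p \<in> carrier ?F" "q \<in> carrier ?F" for p q
    using that keys_diff [of p q] by auto
  have f_diff: "f (p - q) = f p \<ominus>\<^bsub>P\<^esub> f q" if "p \<in> carrier ?F" "q \<in> carrier ?F" for p q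
  proof -
    have "f (p - q) \<oplus>\<^bsub>P\<^esub> f q = f p"
      using linear_on_add [OF f diff [OF that] that(2)] by simp
    moreover have "f (p - q) \<in> carrier P" "f q \<in> carrier P" "f p \<in> carrier P"
      using linear_on_closed [OF f] diff that by blast+
    ultimately show ?thesis
      by (metis P.M.add.inv_solve_right a_minus_def)
  qed
  have single: "Poly_Mapping.single (x, y) c \<in> carrier ?F"
    if "x \<in> carrier M" "y \<in> carrier N" for x y c
    using that by auto
  have cancel2: "(u \<oplus>\<^bsub>P\<^esub> v) \<ominus>\<^bsub>P\<^esub> u \<ominus>\<^bsub>P\<^esub> v = \<zero>\<^bsub>P\<^esub>" if "u \<in> carrier P" "v \<in> carrier P" for u v
  proof -
    have "(u \<oplus>\<^bsub>P\<^esub> v) \<ominus>\<^bsub>P\<^esub> u \<ominus>\<^bsub>P\<^esub> v = (u \<oplus>\<^bsub>P\<^esub> v) \<oplus>\<^bsub>P\<^esub> \<ominus>\<^bsub>P\<^esub> (u \<oplus>\<^bsub>P\<^esub> v)"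
      using that by (simp add: a_minus_def P.M.minus_add P.M.a_assoc)
    then show ?thesis
      using that by (simp add: P.M.r_neg)
  qed
  have cancel1: "u \<ominus>\<^bsub>P\<^esub> u = \<zero>\<^bsub>P\<^esub>" if "u \<in> carrier P" for u
    using that by (simp add: a_minus_def P.M.r_neg)
  have one: "1 \<odot>\<^bsub>P\<^esub> u = u" if "u \<in> carrier P" for u
    using P.smult_one [OF that] by simp
  have "f r = \<zero>\<^bsub>P\<^esub>" if "r \<in> tensor_relations M N" for r
    using that
  proof (cases rule: tensor_relations_cases)
    case (add_left x x' y)
    then show ?thesis
      by (simp only: f_diff single diff f_single M.M.a_closed closed one
          linear_on_add [OF left] P.M.a_closed cancel2)
  next
    case (add_right x y y')
    then show ?thesis
      by (simp only: f_diff single diff f_single N.M.a_closed closed one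
          linear_on_add [OF right] P.M.a_closed cancel2)
  next
    case (smult_left c x y)
    moreover from this have "c \<odot>\<^bsub>M\<^esub> x \<in> carrier M" "c \<odot>\<^bsub>P\<^esub> B x y \<in> carrier P"
      using closed by simp_all
    ultimately show ?thesis
      by (simp only: f_diff single f_single closed one linear_on_smult [OF left] cancel1)
  next
    case (smult_right c x y)
    moreover from this have "c \<odot>\<^bsub>N\<^esub> y \<in> carrier N" "c \<odot>\<^bsub>P\<^esub> B x y \<in> carrier P"
      using closed by simp_all
    ultimately show ?thesis
      by (simp only: f_diff single f_single closed one linear_on_smult [OF right] cancel1)
  qed
  then have "tensor_relations M N \<subseteq> {p \<in> carrier ?F. f p = \<zero>\<^bsub>P\<^esub>}"
    using tensor_relations_subset [OF M N] by blast
  then have "tensor_null M N \<subseteq> {p \<in> carrier ?F. f p = \<zero>\<^bsub>P\<^esub>}"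
    unfolding tensor_null_def
    by (rule genmodule_least [OF submodule_kernel [OF module_free_on_pairs P f]])
  then have "\<And>n. n \<in> tensor_null M N \<Longrightarrow> f n = \<zero>\<^bsub>P\<^esub>"
    by blast
  then obtain g where g: "linear_on (tensor_product M N) P (carrier (tensor_product M N)) g"
    and g_coset: "\<And>p. p \<in> carrier ?F \<Longrightarrow> g (tensor_null M N +>\<^bsub>?F\<^esub> p) = f p"
    using Q.linear_on_factor [OF P f] unfolding tensor_product_def by blast
  have "g (pure_tensor M N x y) = B x y" if "x \<in> carrier M" "y \<in> carrier N" for x y
    unfolding pure_tensor_def
    using that by (simp only: g_coset single f_single one closed)
  with g show ?thesis
    by blast
qed

definition tensor_lift ::
    "('k::field, 'm) module \<Rightarrow> ('k, 'n) module \<Rightarrow> ('k, 'p) module \<Rightarrow> ('m \<Rightarrow> 'n \<Rightarrow> 'p)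
      \<Rightarrow> (('m \<times> 'n) \<Rightarrow>\<^sub>0 'k) set \<Rightarrow> 'p" where
  "tensor_lift M N P B =
    (SOME g. linear_on (tensor_product M N) P (carrier (tensor_product M N)) g \<and>
      (\<forall>x\<in>carrier M. \<forall>y\<in>carrier N. g (pure_tensor M N x y) = B x y))"

context
  fixes M :: "('k::field, 'm) module" and N :: "('k, 'n) module" and P :: "('k, 'p) module"
  assumes modules: "module scalars M" "module scalars N" "module scalars P"
begin

lemma linear_on_tensor_lift:
  "bilinear_map M N P B \<Longrightarrow>
    linear_on (tensor_product M N) P (carrier (tensor_product M N)) (tensor_lift M N P B)"
  unfolding tensor_lift_def using someI_ex [OF tensor_lift_exists [OF modules]] by blast

lemma tensor_lift_pure:
  "bilinear_map M N P B \<Longrightarrow> x \<in> carrier M \<Longrightarrow> y \<in> carrier N \<Longrightarrow>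
    tensor_lift M N P B (pure_tensor M N x y) = B x y"
  unfolding tensor_lift_def using someI_ex [OF tensor_lift_exists [OF modules]] by blast

text \<open>
  Both sides are linear in \<open>z\<close> and agree on pure tensors.  Additivity and homogeneity in the bilinear
  map are what allows lifts to be iterated.
\<close>

lemma tensor_lift_add:
  assumes B: "bilinear_map M N P B" and B': "bilinear_map M N P B'" and C: "bilinear_map M N P C"
    and eq: "\<And>x y. x \<in> carrier M \<Longrightarrow> y \<in> carrier N \<Longrightarrow> C x y = B x y \<oplus>\<^bsub>P\<^esub> B' x y"
    and z: "z \<in> carrier (tensor_product M N)"
  shows "tensor_lift M N P C z = tensor_lift M N P B z \<oplus>\<^bsub>P\<^esub> tensor_lift M N P B' z"
  using z
  by (rule tensor_linear_eqI [OF modules, rotated -1])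
    (auto intro!: linear_on_tensor_lift linear_on_pointwise_add modules assms
      simp: tensor_lift_pure B B' C eq)

lemma tensor_lift_smult:
  assumes B: "bilinear_map M N P B" and C: "bilinear_map M N P C"
    and eq: "\<And>x y. x \<in> carrier M \<Longrightarrow> y \<in> carrier N \<Longrightarrow> C x y = c \<odot>\<^bsub>P\<^esub> B x y"
    and z: "z \<in> carrier (tensor_product M N)"
  shows "tensor_lift M N P C z = c \<odot>\<^bsub>P\<^esub> tensor_lift M N P B z"
  using z
  by (rule tensor_linear_eqI [OF modules, rotated -1])
    (auto intro!: linear_on_tensor_lift linear_on_pointwise_smult modules assms
      simp: tensor_lift_pure B C eq)

text \<open>
  If a family of bilinear maps depends linearly on a parameter \<open>q\<close>, then so does the family of
  lifts.
\<close>

lemma linear_on_tensor_lift_param: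
  assumes bil: "\<And>q. q \<in> carrier Q \<Longrightarrow> bilinear_map M N P (B q)"
    and lin: "\<And>x y. x \<in> carrier M \<Longrightarrow> y \<in> carrier N \<Longrightarrow> linear_on Q P (carrier Q) (\<lambda>q. B q x y)"
    and Q: "module scalars Q"
    and z: "z \<in> carrier (tensor_product M N)"
  shows "linear_on Q P (carrier Q) (\<lambda>q. tensor_lift M N P (B q) z)"
  unfolding linear_on_def
proof (intro conjI ballI allI)
  interpret Q: module scalars Q by fact
  show "(\<lambda>q. tensor_lift M N P (B q) z) \<in> carrier Q \<rightarrow> carrier P"
    using linear_on_closed [OF linear_on_tensor_lift [OF bil] z] by blast
  fix q assume q: "q \<in> carrier Q"
  show "tensor_lift M N P (B (q \<oplus>\<^bsub>Q\<^esub> q')) z =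
      tensor_lift M N P (B q) z \<oplus>\<^bsub>P\<^esub> tensor_lift M N P (B q') z" if "q' \<in> carrier Q" for q'
    using q that z linear_on_add [OF lin] by (intro tensor_lift_add) (auto intro!: bil)
  show "tensor_lift M N P (B (c \<odot>\<^bsub>Q\<^esub> q)) z = c \<odot>\<^bsub>P\<^esub> tensor_lift M N P (B q) z" for c
    using q z linear_on_smult [OF lin] by (intro tensor_lift_smult) (auto intro!: bil)
qed

end

section \<open>Interchange of the middle tensor factors\<close>

text \<open>
  With \<open>B\<close> the four-fold linear expression on the right-hand side, \<open>L\<close> is its lift in the first two
  arguments and the required map is the lift of \<open>L\<close> in the last two.
\<close>

lemma tensor_interchange_exists:
  assumes M1: "module scalars M1" and M2: "module scalars M2"
    and M3: "module scalars M3" and M4: "module scalars M4"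
  defines "T \<equiv> tensor_product (tensor_product M1 M3) (tensor_product M2 M4)"
  shows "\<exists>f. bilinear_map (tensor_product M1 M2) (tensor_product M3 M4) T f \<and>
    (\<forall>y1\<in>carrier M1. \<forall>y2\<in>carrier M2. \<forall>y3\<in>carrier M3. \<forall>y4\<in>carrier M4.
      f (pure_tensor M1 M2 y1 y2) (pure_tensor M3 M4 y3 y4) =
        pure_tensor (tensor_product M1 M3) (tensor_product M2 M4)
          (pure_tensor M1 M3 y1 y3) (pure_tensor M2 M4 y2 y4))"
proof -
  define B where "B = (\<lambda>y3 y4 y1 y2. pure_tensor (tensor_product M1 M3) (tensor_product M2 M4)
    (pure_tensor M1 M3 y1 y3) (pure_tensor M2 M4 y2 y4))"
  define L where "L = (\<lambda>z y3 y4. tensor_lift M1 M2 T (B y3 y4) z)"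
  have T: "module scalars T"
    unfolding T_def by (intro module_tensor_product M1 M2 M3 M4)
  have M12: "module scalars (tensor_product M1 M2)"
    by (intro module_tensor_product M1 M2)
  have outer: "bilinear_map (tensor_product M1 M3) (tensor_product M2 M4) T
      (pure_tensor (tensor_product M1 M3) (tensor_product M2 M4))"
    unfolding T_def by (intro bilinear_map_pure_tensor module_tensor_product M1 M2 M3 M4)
  have outer_right: "linear_on (tensor_product M2 M4) T (carrier (tensor_product M2 M4))
      (pure_tensor (tensor_product M1 M3) (tensor_product M2 M4) u)"
    if "u \<in> carrier (tensor_product M1 M3)" for u
    using outer that by (simp add: bilinear_map_def)
  have outer_left: "linear_on (tensor_product M1 M3) T (carrier (tensor_product M1 M3))
      (\<lambda>u. pure_tensor (tensor_product M1 M3) (tensor_product M2 M4) u v)"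
    if "v \<in> carrier (tensor_product M2 M4)" for v
    using outer that by (simp add: bilinear_map_def)
  note bil13 = bilinear_map_pure_tensor [OF M1 M3] and bil24 = bilinear_map_pure_tensor [OF M2 M4]
  have B1: "linear_on M1 T (carrier M1) (\<lambda>y1. B y3 y4 y1 y2)"
    if "y2 \<in> carrier M2" "y3 \<in> carrier M3" "y4 \<in> carrier M4" for y2 y3 y4
    unfolding B_def using bil13 that
    by (intro linear_on_compose [OF _ outer_left] pure_tensor_closed M2 M4) (simp_all add: bilinear_map_def)
  have B2: "linear_on M2 T (carrier M2) (\<lambda>y2. B y3 y4 y1 y2)"
    if "y1 \<in> carrier M1" "y3 \<in> carrier M3" "y4 \<in> carrier M4" for y1 y3 y4
    unfolding B_def using bil24 that
    by (intro linear_on_compose [OF _ outer_right] pure_tensor_closed M1 M3) (simp_all add: bilinear_map_def)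
  have B3: "linear_on M3 T (carrier M3) (\<lambda>y3. B y3 y4 y1 y2)"
    if "y1 \<in> carrier M1" "y2 \<in> carrier M2" "y4 \<in> carrier M4" for y1 y2 y4
    unfolding B_def using bil13 that
    by (intro linear_on_compose [OF _ outer_left] pure_tensor_closed M2 M4) (simp_all add: bilinear_map_def)
  have B4: "linear_on M4 T (carrier M4) (\<lambda>y4. B y3 y4 y1 y2)"
    if "y1 \<in> carrier M1" "y2 \<in> carrier M2" "y3 \<in> carrier M3" for y1 y2 y3
    unfolding B_def using bil24 that
    by (intro linear_on_compose [OF _ outer_right] pure_tensor_closed M1 M3) (simp_all add: bilinear_map_def)
  have B12: "bilinear_map M1 M2 T (B y3 y4)" if "y3 \<in> carrier M3" "y4 \<in> carrier M4" for y3 y4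
    unfolding bilinear_map_def using B1 B2 that by blast
  have L34: "bilinear_map M3 M4 T (L z)" if z: "z \<in> carrier (tensor_product M1 M2)" for z
    unfolding bilinear_map_def L_def
    by (intro conjI ballI linear_on_tensor_lift_param M1 M2 M3 M4 T z B12 B3 B4)
  have L: "linear_on (tensor_product M1 M2) T (carrier (tensor_product M1 M2)) (\<lambda>z. L z y3 y4)"
    if "y3 \<in> carrier M3" "y4 \<in> carrier M4" for y3 y4
    unfolding L_def by (intro linear_on_tensor_lift M1 M2 T B12 that)
  have "bilinear_map (tensor_product M1 M2) (tensor_product M3 M4) T
      (\<lambda>z. tensor_lift M3 M4 T (L z))"
    unfolding bilinear_map_def
    by (intro conjI ballI linear_on_tensor_lift linear_on_tensor_lift_param M3 M4 T M12 L34 L)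
  moreover have "tensor_lift M3 M4 T (L (pure_tensor M1 M2 y1 y2)) (pure_tensor M3 M4 y3 y4) =
      B y3 y4 y1 y2"
    if "y1 \<in> carrier M1" "y2 \<in> carrier M2" "y3 \<in> carrier M3" "y4 \<in> carrier M4" for y1 y2 y3 y4
  proof -
    have "tensor_lift M3 M4 T (L (pure_tensor M1 M2 y1 y2)) (pure_tensor M3 M4 y3 y4) =
        L (pure_tensor M1 M2 y1 y2) y3 y4"
      using that by (intro tensor_lift_pure M3 M4 T L34 pure_tensor_closed M1 M2)
    also have "\<dots> = B y3 y4 y1 y2"
      unfolding L_def using that by (intro tensor_lift_pure M1 M2 T B12)
    finally show ?thesis .
  qed
  ultimately show ?thesis
    unfolding B_def by blast
qed

section \<open>Coordinate functionals on the algebra\<close>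

lemma free_algebra_simps [simp]:
  "carrier free_algebra = UNIV"
  "p \<oplus>\<^bsub>free_algebra\<^esub> q = p + q"
  "p \<otimes>\<^bsub>free_algebra\<^esub> q = p * q"
  "\<zero>\<^bsub>free_algebra\<^esub> = 0"
  "\<one>\<^bsub>free_algebra\<^esub> = 1"
  "c \<odot>\<^bsub>free_algebra\<^esub> p = Poly_Mapping.map ((*) c) p"
  by (simp_all add: free_algebra_def)

lemma abelian_group_free_algebra: "abelian_group (free_algebra :: ('k::field, 'k free_alg) module)"
  by (rule abelian_groupI) (auto simp: ac_simps intro: exI [of _ "- _"])

lemma ring_free_algebra: "ring (free_algebra :: ('k::field, 'k free_alg) module)"
  by (intro ringI abelian_group_free_algebra monoidI) (simp_all add: algebra_simps)

lemma module_free_algebra: "module scalars (free_algebra :: ('k::field, 'k free_alg) module)"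
  by (intro moduleI abelian_group_free_algebra)
    (auto intro!: poly_mapping_eqI simp: lookup_add algebra_simps)

lemma ideal_plane_ideal: "ideal (plane_ideal \<eta>) free_algebra"
  unfolding plane_ideal_def by (rule ring.genideal_ideal [OF ring_free_algebra]) simp

lemma quotient_module_plane: "quotient_module free_algebra (plane_ideal \<eta>)"
proof -
  interpret ideal "plane_ideal \<eta>" free_algebra
    by (rule ideal_plane_ideal)
  have "Poly_Mapping.map ((*) c) p \<in> plane_ideal \<eta>" if "p \<in> plane_ideal \<eta>" for c p
    unfolding map_times_eq_single_mult
    using I_l_closed [OF that, of "Poly_Mapping.single 0 c"] by simp
  then have "submodule (plane_ideal \<eta>) scalars free_algebra"
    by (intro submodule.intro submodule_axioms.intro a_subgroup) simp
  then show ?thesis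
    by (intro quotient_module.intro module_free_algebra)
qed

lemma module_plane: "module scalars (plane \<eta>)"
  unfolding plane_def by (rule quotient_module.module_FactModule [OF quotient_module_plane])

lemma gen_elem_closed: "gen_elem \<eta> g \<in> carrier (plane \<eta>)"
  unfolding plane_def gen_elem_def
  by (rule quotient_module.coset_closed [OF quotient_module_plane]) simp

text \<open>
  A word of length at most one has only the trivial factorizations.  Thus the coefficient at the empty
  word is multiplicative and the coefficient at a letter is a derivation over it.
\<close>

lemma lookup_mult_short:
  fixes p q :: "'k::field free_alg"
  shows "Poly_Mapping.lookup (p * q) (Word []) =
      Poly_Mapping.lookup p (Word []) * Poly_Mapping.lookup q (Word [])" (is "?A p q")
    and "Poly_Mapping.lookup (p * q) (Word [g]) =
      Poly_Mapping.lookup p (Word []) * Poly_Mapping.lookup q (Word [g]) +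
      Poly_Mapping.lookup p (Word [g]) * Poly_Mapping.lookup q (Word [])" (is "?B p q")
proof -
  have single: "?A (Poly_Mapping.single u a) (Poly_Mapping.single v b) \<and>
      ?B (Poly_Mapping.single u a) (Poly_Mapping.single v b)" for u v a b
    by (cases u; cases v) (auto simp: mult_single lookup_single when_def append_eq_Cons_conv)
  have "?A (Poly_Mapping.single u a) q \<and> ?B (Poly_Mapping.single u a) q" for u a
  proof (induction q rule: poly_mapping_single_add_induct)
    case (add q v b)
    then show ?case
      using single [of u a v b] by (simp add: distrib_left lookup_add algebra_simps)
  qed simp
  then have "?A p q \<and> ?B p q"
  proof (induction p rule: poly_mapping_single_add_induct)
    case (add p u a)
    then show ?case
      using add.prems [of u a] by (simp add: distrib_right lookup_add algebra_simps)
  qed simp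
  then show "?A p q" "?B p q"
    by blast+
qed

text \<open>
  The noncommutative polynomials whose coefficients at the empty word and at the letter \<open>g\<close> both
  vanish form an ideal, and it contains the defining relation.  The empty word has to be included:
  vanishing at \<open>g\<close> alone is not preserved by multiplication with \<open>g\<close>.
\<close>

lemma lookup_plane_ideal:
  assumes "p \<in> plane_ideal \<eta>"
  shows "Poly_Mapping.lookup p (Word [g]) = 0"
proof -
  let ?J = "{p :: 'a free_alg. Poly_Mapping.lookup p (Word []) = 0 \<and> Poly_Mapping.lookup p (Word [g]) = 0}"
  interpret F: module scalars "free_algebra :: ('a, 'a free_alg) module"
    by (rule module_free_algebra)
  have "submodule ?J scalars free_algebra"
  proof (rule F.submoduleI)
    fix p assume p: "p \<in> ?J"
    have "\<ominus>\<^bsub>free_algebra\<^esub> p = - p"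
      by (rule F.M.minus_equality) simp_all
    then show "\<ominus>\<^bsub>free_algebra\<^esub> p \<in> ?J"
      using p by simp
  qed (auto simp: lookup_add)
  then have "ideal ?J free_algebra"
    by (intro idealI ring_free_algebra) (auto simp: lookup_mult_short submodule_def)
  moreover have "free_gen GenX * free_gen GenY - Poly_Mapping.map ((*) \<eta>) (free_gen GenY * free_gen GenX) \<in> ?J"
    by (simp add: free_gen_def lookup_mult_short lookup_minus lookup_single)
  ultimately have "plane_ideal \<eta> \<subseteq> ?J"
    unfolding plane_ideal_def by (intro ring.genideal_minimal ring_free_algebra) simp_all
  then show ?thesis
    using assms by blast
qed

lemma plane_coordinate_exists:
  "\<exists>\<phi>. linear_on (plane \<eta>) ground_module (carrier (plane \<eta>)) \<phi> \<and>
    (\<forall>h. \<phi> (gen_elem \<eta> h) = (if h = g then 1 else 0))"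
proof -
  interpret Q: quotient_module free_algebra "plane_ideal \<eta>"
    by (rule quotient_module_plane)
  let ?f = "\<lambda>p :: 'a free_alg. Poly_Mapping.lookup p (Word [g])"
  have "linear_on free_algebra ground_module (carrier free_algebra) ?f"
    by (simp add: linear_on_def lookup_add)
  then obtain \<phi> where "linear_on (plane \<eta>) ground_module (carrier (plane \<eta>)) \<phi>"
    and "\<And>p. \<phi> (plane_ideal \<eta> +>\<^bsub>free_algebra\<^esub> p) = ?f p"
    using Q.linear_on_factor [OF module_ground_module, of ?f] lookup_plane_ideal [of _ \<eta> g]
    unfolding plane_def by auto
  then show ?thesis
    by (intro exI [of _ \<phi>]) (auto simp: gen_elem_def free_gen_def lookup_single when_def)
qed

section \<open>Existence of the square and of the coproduct\<close>

text \<open>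
  Products of the coordinate functionals form a dual family \<open>\<psi>\<close> to the four tensors of generators,
  so these are linearly independent and \<open>\<Sum> \<psi>\<^sub>g\<^sub>h(z) v\<^sub>g\<^sub>h\<close> takes the prescribed values on them.
\<close>

lemma plane2_extend_from_generators:
  fixes \<eta> :: "'k::field" and P :: "('k, 'p) module"
  assumes P: "module scalars P" and v: "\<And>g h. v g h \<in> carrier P"
  shows "\<exists>D. linear_on (plane2 \<eta>) P (carrier (plane2 \<eta>)) D \<and>
    (\<forall>g h. D (gen_elem \<eta> g \<otimes>\<^sub>2[\<eta>] gen_elem \<eta> h) = v g h)"
proof -
  interpret P: module scalars P by fact
  obtain \<phi> where \<phi>: "\<And>g. linear_on (plane \<eta>) ground_module (carrier (plane \<eta>)) (\<phi> g)"
    and \<phi>_gen: "\<And>g h. \<phi> g (gen_elem \<eta> h) = (if h = g then 1 else 0)"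
    using plane_coordinate_exists [of \<eta>] by metis
  have prod: "bilinear_map (plane \<eta>) (plane \<eta>) ground_module (\<lambda>x y. \<phi> g x * \<phi> h y)" for g h
    unfolding bilinear_map_def linear_on_def
    using linear_on_add [OF \<phi>] linear_on_smult [OF \<phi>] by (simp add: algebra_simps)
  define \<psi> where "\<psi> = (\<lambda>g h. tensor_lift (plane \<eta>) (plane \<eta>) ground_module (\<lambda>x y. \<phi> g x * \<phi> h y))"
  have \<psi>: "linear_on (plane2 \<eta>) ground_module (carrier (plane2 \<eta>)) (\<psi> g h)" for g h
    unfolding \<psi>_def by (intro linear_on_tensor_lift module_plane module_ground_module prod)
  have \<psi>_gen: "\<psi> g h (gen_elem \<eta> g' \<otimes>\<^sub>2[\<eta>] gen_elem \<eta> h') = (if g' = g \<and> h' = h then 1 else 0)" for g h g' h'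
    unfolding \<psi>_def
    by (simp add: tensor_lift_pure module_plane module_ground_module prod gen_elem_closed \<phi>_gen)
  define D where "D = (\<lambda>z. \<psi> GenX GenX z \<odot>\<^bsub>P\<^esub> v GenX GenX \<oplus>\<^bsub>P\<^esub> \<psi> GenX GenY z \<odot>\<^bsub>P\<^esub> v GenX GenY \<oplus>\<^bsub>P\<^esub>
    (\<psi> GenY GenX z \<odot>\<^bsub>P\<^esub> v GenY GenX \<oplus>\<^bsub>P\<^esub> \<psi> GenY GenY z \<odot>\<^bsub>P\<^esub> v GenY GenY))"
  have "linear_on (plane2 \<eta>) P (carrier (plane2 \<eta>)) D"
    unfolding D_def by (intro linear_on_pointwise_add linear_on_functional_smult P \<psi> v)
  moreover have "D (gen_elem \<eta> g \<otimes>\<^sub>2[\<eta>] gen_elem \<eta> h) = v g h" for g h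
    using v P.smult_l_null [OF v] P.smult_one [OF v]
    by (cases g; cases h) (simp_all add: D_def \<psi>_gen)
  ultimately show ?thesis
    by blast
qed

lemma is_square_square: "is_square \<eta> (square \<eta>)"
  unfolding square_def
proof (rule someI_ex [where P = "is_square \<eta>"])
  show "\<exists>f. is_square \<eta> f"
    unfolding is_square_def
    by (rule tensor_interchange_exists) (rule module_plane)+
qed

lemma square_pure_gens:
  "square \<eta> (gen_elem \<eta> g1 \<otimes>\<^sub>2[\<eta>] gen_elem \<eta> g2) (gen_elem \<eta> g3 \<otimes>\<^sub>2[\<eta>] gen_elem \<eta> g4) =
    (gen_elem \<eta> g1 \<otimes>\<^sub>2[\<eta>] gen_elem \<eta> g3) \<otimes>\<^sub>4[\<eta>] (gen_elem \<eta> g2 \<otimes>\<^sub>2[\<eta>] gen_elem \<eta> g4)"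
  using is_square_square [of \<eta>] gen_elem_closed [of \<eta>] unfolding is_square_def by blast

lemma is_coproduct_coproduct: "is_coproduct \<eta> (coproduct \<eta>)"
  unfolding coproduct_def
proof (rule someI_ex [where P = "is_coproduct \<eta>"])
  let ?a = "elem_a \<eta>" and ?b = "elem_b \<eta>" and ?c = "elem_c \<eta>" and ?d = "elem_d \<eta>"
  have P2: "module scalars (plane2 \<eta>)" and P4: "module scalars (plane4 \<eta>)"
    by (intro module_tensor_product module_plane)+
  interpret P4: module scalars "plane4 \<eta>"
    by (rule P4)
  have closed: "?a \<in> carrier (plane2 \<eta>)" "?b \<in> carrier (plane2 \<eta>)"
      "?c \<in> carrier (plane2 \<eta>)" "?d \<in> carrier (plane2 \<eta>)"
    unfolding elem_a_def elem_b_def elem_c_def elem_d_def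
    by (intro pure_tensor_closed module_plane gen_elem_closed)+
  define v where "v = (\<lambda>g h. case g of
      GenX \<Rightarrow> (case h of
        GenX \<Rightarrow> (?a \<otimes>\<^sub>4[\<eta>] ?a) \<oplus>\<^bsub>plane4 \<eta>\<^esub> (?b \<otimes>\<^sub>4[\<eta>] ?c)
      | GenY \<Rightarrow> (?a \<otimes>\<^sub>4[\<eta>] ?b) \<oplus>\<^bsub>plane4 \<eta>\<^esub> (?b \<otimes>\<^sub>4[\<eta>] ?d))
    | GenY \<Rightarrow> (case h of
        GenX \<Rightarrow> (?d \<otimes>\<^sub>4[\<eta>] ?c) \<oplus>\<^bsub>plane4 \<eta>\<^esub> (?c \<otimes>\<^sub>4[\<eta>] ?a)
      | GenY \<Rightarrow> (?d \<otimes>\<^sub>4[\<eta>] ?d) \<oplus>\<^bsub>plane4 \<eta>\<^esub> (?c \<otimes>\<^sub>4[\<eta>] ?b)))"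
  have "v g h \<in> carrier (plane4 \<eta>)" for g h
    by (cases g; cases h; simp only: v_def gen.case; intro P4.M.a_closed pure_tensor_closed P2 closed)
  then obtain D where D: "linear_on (plane2 \<eta>) (plane4 \<eta>) (carrier (plane2 \<eta>)) D"
    and D_gen: "\<And>g h. D (gen_elem \<eta> g \<otimes>\<^sub>2[\<eta>] gen_elem \<eta> h) = v g h"
    using plane2_extend_from_generators [OF P4] by metis
  have D_elems: "D ?a = v GenX GenX" "D ?b = v GenX GenY" "D ?c = v GenY GenX" "D ?d = v GenY GenY"
    unfolding elem_a_def elem_b_def elem_c_def elem_d_def by (rule D_gen)+
  have "genmodule (plane2 \<eta>) {?a, ?b, ?c, ?d} \<subseteq> carrier (plane2 \<eta>)"
    using closed by (intro genmodule_least module.carrier_is_submodule P2) simp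
  then have "linear_on (plane2 \<eta>) (plane4 \<eta>) (genmodule (plane2 \<eta>) {?a, ?b, ?c, ?d}) D"
    by (rule linear_on_subset [OF D])
  then show "\<exists>D. is_coproduct \<eta> D"
    unfolding is_coproduct_def Let_def
    by (intro exI [of _ D] conjI) (simp_all only: D_elems v_def gen.case)
qed

theorem proposition2p14:
  fixes \<eta> :: "'k::real_normed_field"
  assumes "\<eta> \<noteq> 0"
  shows "bracket \<eta> (DeltaM \<eta> GenX) (DeltaM_tilde \<eta> GenX) = coproduct \<eta> (elem_a \<eta>) \<and>
         bracket \<eta> (DeltaM \<eta> GenY) (DeltaM_tilde \<eta> GenY) = coproduct \<eta> (elem_d \<eta>) \<and>
         per \<eta> (DeltaM \<eta> GenX) (DeltaM_tilde \<eta> GenY) = coproduct \<eta> (elem_b \<eta>) \<and>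
         per \<eta> (DeltaM \<eta> GenY) (DeltaM_tilde \<eta> GenX) = coproduct \<eta> (elem_c \<eta>)"
proof -
  have "coproduct \<eta> (elem_a \<eta>) = (elem_a \<eta> \<otimes>\<^sub>4[\<eta>] elem_a \<eta>) \<oplus>\<^bsub>plane4 \<eta>\<^esub> (elem_b \<eta> \<otimes>\<^sub>4[\<eta>] elem_c \<eta>)"
    "coproduct \<eta> (elem_b \<eta>) = (elem_a \<eta> \<otimes>\<^sub>4[\<eta>] elem_b \<eta>) \<oplus>\<^bsub>plane4 \<eta>\<^esub> (elem_b \<eta> \<otimes>\<^sub>4[\<eta>] elem_d \<eta>)"
    "coproduct \<eta> (elem_c \<eta>) = (elem_d \<eta> \<otimes>\<^sub>4[\<eta>] elem_c \<eta>) \<oplus>\<^bsub>plane4 \<eta>\<^esub> (elem_c \<eta> \<otimes>\<^sub>4[\<eta>] elem_a \<eta>)"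
    "coproduct \<eta> (elem_d \<eta>) = (elem_d \<eta> \<otimes>\<^sub>4[\<eta>] elem_d \<eta>) \<oplus>\<^bsub>plane4 \<eta>\<^esub> (elem_c \<eta> \<otimes>\<^sub>4[\<eta>] elem_b \<eta>)"
    using is_coproduct_coproduct [of \<eta>] unfolding is_coproduct_def Let_def by blast+
  then show ?thesis
    by (simp only: bracket_def per_def DeltaM.simps DeltaM_tilde.simps fst_conv snd_conv
        square_pure_gens elem_a_def elem_b_def elem_c_def elem_d_def)
qed

end
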